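(* (1) Let $S$ be an Ehresmann semigroup which is proper left restriction (respectively proper right restriction). Then it is a strictly proper Ehresmann semigroup, its underlying partial multiaction $\mathcal G_S$ satisfies condition (LD) (respectively condition (RD)) and $S$ is isomorphic to $P(S)\rtimes_{\mathcal G_S}S/\sigma$. (2) Let $S$ be a proper restriction semigroup. Then it is a strictly proper Ehresmann semigroup, its underlying partial multiaction $\mathcal G_S$ satisfies conditions (LD) and (RD) and $S$ is isomorphic to $P(S)\rtimes_{\mathcal G_S}S/\sigma$.
   Context: **Ehresmann and restriction semigroups.** An Ehresmann semigroup is an algebra $(S;\cdot\,,{}^+,{}^* )$ with $(S;\cdot)$ a semigroup and unary operations ${}^+,{}^*$ satisfying $x^+x=x$, $(x^+y^+)^+=x^+y^+=y^+x^+$, $(xy)^+=(xy^+)^+$, $xx^*=x$, $(x^*y^* )^*=x^*y^*=y^*x^*$, $(xy)^*=(x^*y)^*$, $(x^+)^*=x^+$, $(x^* )^+=x^*$. $P(S)=\{s^+\colon s\in S\}=\{s^*\colon s\in S\}$ is the semilattice of projections ($e\le f$ iff $e=ef$). $\sigma$ is the minimum congruence on $S$ identifying all elements of $P(S)$; $[a]_\sigma$ is the class of $a$; $S/\sigma$ is a monoid with identity $1$ the common class of projections. An Ehresmann semigroup is left restriction if $xy^+=(xy)^+x$ holds, right restriction if $x^*y=y(xy)^*$ holds, and a restriction semigroup if both hold. It is proper left restriction if it is left restriction and $a^+=b^+$, $a\mathrel{\sigma}b$ imply $a=b$; proper right restriction if it is right restriction and $a^*=b^*$, $a\mathrel{\sigma}b$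 imply $a=b$; a proper restriction semigroup if it is both. An Ehresmann semigroup is strictly proper if for all $s,t\in S$: $t^+=s^+$, $t^*=s^*$ and $t\mathrel{\sigma}s$ imply $t=s$. **The underlying partial multiaction.** For strictly proper $S$, $\mathcal G_S$ is the labelled directed graph with vertex set $P(S)$ and edges $(a^+,[a]_\sigma,a^* )$, $a\in S$ (from $a^+$ to $a^*$, labelled by $[a]_\sigma\in S/\sigma$). It is a category with composition $(e,s,f)(f,t,g)=(e,st,g)$. For an edge $c=(a^+,[a]_\sigma,a^* )$ put $\mathbf d(c)=a^+$, $\mathbf r(c)=a^*$, and, for $g\le a^+$, $h\le a^*$: ${}_g|c=(g,[a]_\sigma,(ga)^* )$, $c|_h=((ah)^+,[a]_\sigma,h)$. (LD): for all $t\in S/\sigma$ and $e\in P(S)$ there is at most one $f\in P(S)$ such that $(e,t,f)$ is an edge. (RD): for all $t\in S/\sigma$ and $f\in P(S)$ there is at most one $e\in P(S)$ such that $(e,t,f)$ is an edge. **$P(S)\rtimes_{\mathcal G_S}S/\sigma$** is the Ehresmann semigroup whose underlying set is the set of edges of $\mathcal G_S$, with $c\cdot d=(c|_{\mathbf r(c)\mathbf d(d)})({}_{\mathbf r(c)\mathbf d(d)}|d)$ (composition in the category $\mathcal G_S$), $c^+=(\mathbf d(c),1,\mathbf d(c))$, $c^*=(\mathbf r(c),1,\mathbf r(c))$. Isomorphisms are $(2,1,1)$-isomorphisms. *)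

theory Defs
  imports "HOL-Algebra.Group"
begin

record 'a biunary_semigroup = "'a partial_object" +
  dot :: "['a, 'a] \<Rightarrow> 'a"  (infixl "\<cdot>\<index>" 70)
  plus_op :: "'a \<Rightarrow> 'a"  ("_\<^bsup>+\<^esup>\<index>" [90] 90)
  star_op :: "'a \<Rightarrow> 'a"  ("_\<^bsup>*\<^esup>\<index>" [90] 90)

locale ehresmann_semigroup =
  fixes S (structure)
  assumes dot_closed: "\<lbrakk>x \<in> carrier S; y \<in> carrier S\<rbrakk> \<Longrightarrow> x \<cdot> y \<in> carrier S"
    and plus_closed: "x \<in> carrier S \<Longrightarrow> x\<^bsup>+\<^esup> \<in> carrier S"
    and star_closed: "x \<in> carrier S \<Longrightarrow> x\<^bsup>*\<^esup> \<in> carrier S"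
    and dot_assoc: "\<lbrakk>x \<in> carrier S; y \<in> carrier S; z \<in> carrier S\<rbrakk> \<Longrightarrow> (x \<cdot> y) \<cdot> z = x \<cdot> (y \<cdot> z)"
    and plus_left_id: "x \<in> carrier S \<Longrightarrow> x\<^bsup>+\<^esup> \<cdot> x = x"
    and plus_dot_plus: "\<lbrakk>x \<in> carrier S; y \<in> carrier S\<rbrakk> \<Longrightarrow> (x\<^bsup>+\<^esup> \<cdot> y\<^bsup>+\<^esup>)\<^bsup>+\<^esup> = x\<^bsup>+\<^esup> \<cdot> y\<^bsup>+\<^esup>"
    and plus_comm: "\<lbrakk>x \<in> carrier S; y \<in> carrier S\<rbrakk> \<Longrightarrow> x\<^bsup>+\<^esup> \<cdot> y\<^bsup>+\<^esup> = y\<^bsup>+\<^esup> \<cdot> x\<^bsup>+\<^esup>"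
    and plus_dot: "\<lbrakk>x \<in> carrier S; y \<in> carrier S\<rbrakk> \<Longrightarrow> (x \<cdot> y)\<^bsup>+\<^esup> = (x \<cdot> y\<^bsup>+\<^esup>)\<^bsup>+\<^esup>"
    and star_right_id: "x \<in> carrier S \<Longrightarrow> x \<cdot> x\<^bsup>*\<^esup> = x"
    and star_dot_star: "\<lbrakk>x \<in> carrier S; y \<in> carrier S\<rbrakk> \<Longrightarrow> (x\<^bsup>*\<^esup> \<cdot> y\<^bsup>*\<^esup>)\<^bsup>*\<^esup> = x\<^bsup>*\<^esup> \<cdot> y\<^bsup>*\<^esup>"
    and star_comm: "\<lbrakk>x \<in> carrier S; y \<in> carrier S\<rbrakk> \<Longrightarrow> x\<^bsup>*\<^esup> \<cdot> y\<^bsup>*\<^esup> = y\<^bsup>*\<^esup> \<cdot> x\<^bsup>*\<^esup>"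
    and star_dot: "\<lbrakk>x \<in> carrier S; y \<in> carrier S\<rbrakk> \<Longrightarrow> (x \<cdot> y)\<^bsup>*\<^esup> = (x\<^bsup>*\<^esup> \<cdot> y)\<^bsup>*\<^esup>"
    and star_plus: "x \<in> carrier S \<Longrightarrow> (x\<^bsup>+\<^esup>)\<^bsup>*\<^esup> = x\<^bsup>+\<^esup>"
    and plus_star: "x \<in> carrier S \<Longrightarrow> (x\<^bsup>*\<^esup>)\<^bsup>+\<^esup> = x\<^bsup>*\<^esup>"

text \<open>In an Ehresmann semigroup the image of \<open>\<^bsup>*\<^esup>\<close> is the same set, by the last two axioms.\<close>

definition projections :: "('a, 'm) biunary_semigroup_scheme \<Rightarrow> 'a set" where
  "projections S = plus_op S ` carrier S"

definition congruence :: "('a, 'm) biunary_semigroup_scheme \<Rightarrow> 'a rel \<Rightarrow> bool" where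
  "congruence S r \<longleftrightarrow> equiv (carrier S) r \<and>
     (\<forall>(a, b) \<in> r. \<forall>(c, d) \<in> r. (a \<cdot>\<^bsub>S\<^esub> c, b \<cdot>\<^bsub>S\<^esub> d) \<in> r) \<and>
     (\<forall>(a, b) \<in> r. (a\<^bsup>+\<^esup>\<^bsub>S\<^esub>, b\<^bsup>+\<^esup>\<^bsub>S\<^esub>) \<in> r \<and> (a\<^bsup>*\<^esup>\<^bsub>S\<^esub>, b\<^bsup>*\<^esup>\<^bsub>S\<^esub>) \<in> r)"

text \<open>Compatibility with the unary operations is automatic for a semigroup congruence that
  identifies all projections, so \<open>sigma\<close> is also the minimum such semigroup congruence.\<close>

definition sigma :: "('a, 'm) biunary_semigroup_scheme \<Rightarrow> 'a rel" where
  "sigma S = \<Inter>{r. congruence S r \<and> projections S \<times> projections S \<subseteq> r}"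

definition sigma_class :: "('a, 'm) biunary_semigroup_scheme \<Rightarrow> 'a \<Rightarrow> 'a set" where
  "sigma_class S a = sigma S `` {a}"

text \<open>The image of \<open>projections S\<close> under \<open>sigma S\<close> is the common class of all projections.\<close>

definition quotient_monoid :: "('a, 'm) biunary_semigroup_scheme \<Rightarrow> 'a set monoid" where
  "quotient_monoid S =
     \<lparr>carrier = carrier S // sigma S,
      mult = (\<lambda>X Y. \<Union>x\<in>X. \<Union>y\<in>Y. sigma_class S (x \<cdot>\<^bsub>S\<^esub> y)),
      one = sigma S `` projections S\<rparr>"

locale left_restriction_semigroup = ehresmann_semigroup +
  assumes left_ample: "\<lbrakk>x \<in> carrier S; y \<in> carrier S\<rbrakk> \<Longrightarrow> x \<cdot> y\<^bsup>+\<^esup> = (x \<cdot> y)\<^bsup>+\<^esup> \<cdot> x"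

locale right_restriction_semigroup = ehresmann_semigroup +
  assumes right_ample: "\<lbrakk>x \<in> carrier S; y \<in> carrier S\<rbrakk> \<Longrightarrow> x\<^bsup>*\<^esup> \<cdot> y = y \<cdot> (x \<cdot> y)\<^bsup>*\<^esup>"

locale proper_left_restriction_semigroup = left_restriction_semigroup +
  assumes left_proper:
    "\<lbrakk>a \<in> carrier S; b \<in> carrier S; a\<^bsup>+\<^esup> = b\<^bsup>+\<^esup>; (a, b) \<in> sigma S\<rbrakk> \<Longrightarrow> a = b"

locale proper_right_restriction_semigroup = right_restriction_semigroup +
  assumes right_proper:
    "\<lbrakk>a \<in> carrier S; b \<in> carrier S; a\<^bsup>*\<^esup> = b\<^bsup>*\<^esup>; (a, b) \<in> sigma S\<rbrakk> \<Longrightarrow> a = b"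

locale proper_restriction_semigroup =
  proper_left_restriction_semigroup + proper_right_restriction_semigroup

locale strictly_proper_ehresmann_semigroup = ehresmann_semigroup +
  assumes strictly_proper:
    "\<lbrakk>s \<in> carrier S; t \<in> carrier S; t\<^bsup>+\<^esup> = s\<^bsup>+\<^esup>; t\<^bsup>*\<^esup> = s\<^bsup>*\<^esup>; (t, s) \<in> sigma S\<rbrakk> \<Longrightarrow> t = s"

text \<open>An edge \<open>(e, t, f)\<close> goes from \<open>e\<close> to \<open>f\<close> and has label \<open>t\<close>.\<close>

record ('v, 'l) labelled_digraph =
  vertices :: "'v set"
  edges :: "('v \<times> 'l \<times> 'v) set"

definition edge_of :: "('a, 'm) biunary_semigroup_scheme \<Rightarrow> 'a \<Rightarrow> 'a \<times> 'a set \<times> 'a" where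
  "edge_of S a = (a\<^bsup>+\<^esup>\<^bsub>S\<^esub>, sigma_class S a, a\<^bsup>*\<^esup>\<^bsub>S\<^esub>)"

definition partial_multiaction ::
    "('a, 'm) biunary_semigroup_scheme \<Rightarrow> ('a, 'a set) labelled_digraph" where
  "partial_multiaction S = \<lparr>vertices = projections S, edges = edge_of S ` carrier S\<rparr>"

definition condition_LD ::
    "('l, 'n) monoid_scheme \<Rightarrow> ('v, 'l, 'k) labelled_digraph_scheme \<Rightarrow> bool" where
  "condition_LD T G \<longleftrightarrow>
     (\<forall>t \<in> carrier T. \<forall>e \<in> vertices G. \<exists>\<^sub>\<le>\<^sub>1f. f \<in> vertices G \<and> (e, t, f) \<in> edges G)"

definition condition_RD ::
    "('l, 'n) monoid_scheme \<Rightarrow> ('v, 'l, 'k) labelled_digraph_scheme \<Rightarrow> bool" where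
  "condition_RD T G \<longleftrightarrow>
     (\<forall>t \<in> carrier T. \<forall>f \<in> vertices G. \<exists>\<^sub>\<le>\<^sub>1e. e \<in> vertices G \<and> (e, t, f) \<in> edges G)"

fun source :: "'v \<times> 'l \<times> 'v \<Rightarrow> 'v" where "source (e, t, f) = e"
fun label :: "'v \<times> 'l \<times> 'v \<Rightarrow> 'l" where "label (e, t, f) = t"
fun target :: "'v \<times> 'l \<times> 'v \<Rightarrow> 'v" where "target (e, t, f) = f"

text \<open>Composition is intended only for edges where the target of the first is the source of
  the second.\<close>

fun compose_edges ::
    "('l, 'n) monoid_scheme \<Rightarrow> 'v \<times> 'l \<times> 'v \<Rightarrow> 'v \<times> 'l \<times> 'v \<Rightarrow> 'v \<times> 'l \<times> 'v" where
  "compose_edges T (e, s, f) (f', t, g) = (e, s \<otimes>\<^bsub>T\<^esub> t, g)"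

text \<open>If \<open>S\<close> is strictly proper, then \<open>edge_of S\<close> is injective on \<open>carrier S\<close>, so an edge
  \<open>c\<close> comes from a unique element.\<close>

definition edge_elem :: "('a, 'm) biunary_semigroup_scheme \<Rightarrow> 'a \<times> 'a set \<times> 'a \<Rightarrow> 'a" where
  "edge_elem S = the_inv_into (carrier S) (edge_of S)"

text \<open>The restriction \<open>\<^bsub>g\<^esub>|c\<close> is meant for projections \<open>g \<le> source c\<close>, and the
  corestriction \<open>c|\<^bsub>h\<^esub>\<close> for projections \<open>h \<le> target c\<close>.\<close>

definition restrict_edge ::
    "('a, 'm) biunary_semigroup_scheme \<Rightarrow> 'a \<Rightarrow> 'a \<times> 'a set \<times> 'a \<Rightarrow> 'a \<times> 'a set \<times> 'a" where
  "restrict_edge S g c = (g, label c, (g \<cdot>\<^bsub>S\<^esub> edge_elem S c)\<^bsup>*\<^esup>\<^bsub>S\<^esub>)"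

definition corestrict_edge ::
    "('a, 'm) biunary_semigroup_scheme \<Rightarrow> 'a \<times> 'a set \<times> 'a \<Rightarrow> 'a \<Rightarrow> 'a \<times> 'a set \<times> 'a" where
  "corestrict_edge S c h = ((edge_elem S c \<cdot>\<^bsub>S\<^esub> h)\<^bsup>+\<^esup>\<^bsub>S\<^esub>, label c, h)"

text \<open>The semigroup \<open>P(S) \<rtimes> S/\<sigma>\<close> built from the underlying partial multiaction of \<open>S\<close>.\<close>

definition multiaction_product ::
    "('a, 'm) biunary_semigroup_scheme \<Rightarrow> ('a \<times> 'a set \<times> 'a) biunary_semigroup" where
  "multiaction_product S =
     \<lparr>carrier = edges (partial_multiaction S),
      dot = (\<lambda>c d. let m = target c \<cdot>\<^bsub>S\<^esub> source d in
               compose_edges (quotient_monoid S) (corestrict_edge S c m) (restrict_edge S m d)),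
      plus_op = (\<lambda>c. (source c, \<one>\<^bsub>quotient_monoid S\<^esub>, source c)),
      star_op = (\<lambda>c. (target c, \<one>\<^bsub>quotient_monoid S\<^esub>, target c))\<rparr>"

definition biunary_hom ::
    "('a, 'm) biunary_semigroup_scheme \<Rightarrow> ('b, 'n) biunary_semigroup_scheme \<Rightarrow> ('a \<Rightarrow> 'b) set"
  where
  "biunary_hom S T = {h. h \<in> carrier S \<rightarrow> carrier T \<and>
     (\<forall>x \<in> carrier S. \<forall>y \<in> carrier S. h (x \<cdot>\<^bsub>S\<^esub> y) = h x \<cdot>\<^bsub>T\<^esub> h y) \<and>
     (\<forall>x \<in> carrier S. h (x\<^bsup>+\<^esup>\<^bsub>S\<^esub>) = (h x)\<^bsup>+\<^esup>\<^bsub>T\<^esub>) \<and>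
     (\<forall>x \<in> carrier S. h (x\<^bsup>*\<^esup>\<^bsub>S\<^esub>) = (h x)\<^bsup>*\<^esup>\<^bsub>T\<^esub>)}"

definition biunary_isomorphic ::
    "('a, 'm) biunary_semigroup_scheme \<Rightarrow> ('b, 'n) biunary_semigroup_scheme \<Rightarrow> bool" where
  "biunary_isomorphic S T \<longleftrightarrow> (\<exists>h \<in> biunary_hom S T. bij_betw h (carrier S) (carrier T))"

end

theory Submission
  imports Defs
begin

text \<open>
  Each element \<open>a\<close> of an Ehresmann semigroup leaves three traces, collected in its edge
  \<open>(a\<^sup>+, [a], a\<^sup>*)\<close>. Strict properness says exactly that \<open>a\<close> is determined by its edge, whereas
  one-sided properness says that two of the three entries suffice. So one-sided properness is a
  stronger injectivity condition, and it forces the label and one end of an edge to determine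
  the other end, which is (LD) or (RD).

  The isomorphism is the map sending \<open>a\<close> to its edge, a bijection by strict properness.
  It is multiplicative because the Ehresmann identities make each end of a product depend on one
  factor only through a projection: with \<open>m = a\<^sup>* b\<^sup>+\<close>, both \<open>(ab)\<^sup>+ = (ab\<^sup>+)\<^sup>+ = (am)\<^sup>+\<close> and
  \<open>(ab)\<^sup>* = (a\<^sup>* b)\<^sup>* = (mb)\<^sup>*\<close>, and these are the ends of the product of the two edges. The
  left and the right case share this argument: both pass through strict properness, for which it
  is carried out in \<open>isomorphic_multiaction_product\<close>.
\<close>

context ehresmann_semigroup
begin

lemma plus_plus: "x \<in> carrier S \<Longrightarrow> (x\<^bsup>+\<^esup>)\<^bsup>+\<^esup> = x\<^bsup>+\<^esup>"
  by (metis plus_closed plus_star star_plus)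

lemma star_star: "x \<in> carrier S \<Longrightarrow> (x\<^bsup>*\<^esup>)\<^bsup>*\<^esup> = x\<^bsup>*\<^esup>"
  by (metis star_closed plus_star star_plus)

lemma plus_in_projections: "x \<in> carrier S \<Longrightarrow> x\<^bsup>+\<^esup> \<in> projections S"
  by (simp add: projections_def)

lemma star_in_projections: "x \<in> carrier S \<Longrightarrow> x\<^bsup>*\<^esup> \<in> projections S"
  by (metis plus_in_projections plus_star star_closed)

lemma projections_subset: "projections S \<subseteq> carrier S"
  by (auto simp: projections_def plus_closed)

text \<open>The total relation belongs to the family of congruences intersected in \<open>sigma S\<close>. This
  confines \<open>sigma S\<close> to \<open>carrier S\<close>.\<close>

lemma congruence_total: "congruence S (carrier S \<times> carrier S)"
  by (auto simp: congruence_def dot_closed plus_closed star_closed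
      intro!: equivI refl_onI symI transI)

lemma sigma_subset: "sigma S \<subseteq> carrier S \<times> carrier S"
  using congruence_total projections_subset unfolding sigma_def by blast

lemma congruence_sigma: "congruence S (sigma S)"
proof -
  have eq: "equiv (carrier S) r" if "congruence S r" for r
    using that by (simp add: congruence_def)
  have "equiv (carrier S) (sigma S)"
  proof (rule equivI)
    show "sigma S \<subseteq> carrier S \<times> carrier S"
      by (rule sigma_subset)
    show "refl_on (carrier S) (sigma S)"
      using eq unfolding sigma_def by (auto intro!: refl_onI dest: equiv_class_self)
    show "sym (sigma S)"
      unfolding sigma_def
      by (rule symI) (use eq in \<open>blast elim: equivE dest: symD\<close>)
    show "trans (sigma S)"
      unfolding sigma_def
      by (rule transI) (use eq in \<open>blast elim: equivE dest: transD\<close>)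
  qed
  then show ?thesis
    unfolding congruence_def sigma_def by blast
qed

lemma equiv_sigma: "equiv (carrier S) (sigma S)"
  using congruence_sigma by (simp add: congruence_def)

lemma sigma_dot: "\<lbrakk>(a, b) \<in> sigma S; (c, d) \<in> sigma S\<rbrakk> \<Longrightarrow> (a \<cdot> c, b \<cdot> d) \<in> sigma S"
  using congruence_sigma unfolding congruence_def by blast

lemma sigma_projections: "\<lbrakk>e \<in> projections S; f \<in> projections S\<rbrakk> \<Longrightarrow> (e, f) \<in> sigma S"
  unfolding sigma_def by blast

lemma sigma_class_eq_iff:
  "\<lbrakk>a \<in> carrier S; b \<in> carrier S\<rbrakk> \<Longrightarrow> sigma_class S a = sigma_class S b \<longleftrightarrow> (a, b) \<in> sigma S"
  unfolding sigma_class_def by (rule eq_equiv_class_iff [OF equiv_sigma])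

lemma sigma_class_mult:
  assumes a: "a \<in> carrier S" and b: "b \<in> carrier S"
  shows "sigma_class S a \<otimes>\<^bsub>quotient_monoid S\<^esub> sigma_class S b = sigma_class S (a \<cdot> b)"
proof -
  have class_eq: "sigma_class S (x \<cdot> y) = sigma_class S (a \<cdot> b)"
    if "x \<in> sigma_class S a" "y \<in> sigma_class S b" for x y
    using that sigma_dot [of a x b y] equiv_class_eq [OF equiv_sigma]
    unfolding sigma_class_def by blast
  have "a \<in> sigma_class S a" "b \<in> sigma_class S b"
    using a b equiv_class_self [OF equiv_sigma] unfolding sigma_class_def by blast+
  then have "(\<Union>x\<in>sigma_class S a. \<Union>y\<in>sigma_class S b. sigma_class S (x \<cdot> y))
      = sigma_class S (a \<cdot> b)"
    using class_eq by blast
  then show ?thesis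
    by (simp add: quotient_monoid_def)
qed

lemma sigma_class_projection:
  assumes "e \<in> projections S"
  shows "sigma_class S e = \<one>\<^bsub>quotient_monoid S\<^esub>"
proof -
  have "sigma S `` {f} = sigma S `` {e}" if "f \<in> projections S" for f
    using equiv_class_eq [OF equiv_sigma] sigma_projections that assms by blast
  then have "sigma S `` projections S = sigma S `` {e}"
    using assms by blast
  then show ?thesis
    by (simp add: quotient_monoid_def sigma_class_def)
qed

lemma edge_of_plus:
  assumes "a \<in> carrier S"
  shows "edge_of S (a\<^bsup>+\<^esup>) = (a\<^bsup>+\<^esup>, \<one>\<^bsub>quotient_monoid S\<^esub>, a\<^bsup>+\<^esup>)"
  by (simp add: edge_of_def assms plus_plus star_plus sigma_class_projection plus_in_projections)

lemma edge_of_star: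
  assumes "a \<in> carrier S"
  shows "edge_of S (a\<^bsup>*\<^esup>) = (a\<^bsup>*\<^esup>, \<one>\<^bsub>quotient_monoid S\<^esub>, a\<^bsup>*\<^esup>)"
  by (simp add: edge_of_def assms star_star plus_star sigma_class_projection star_in_projections)

text \<open>The middle projection \<open>a\<^sup>* b\<^sup>+\<close> of a product acts on \<open>a\<close> as \<open>b\<^sup>+\<close> does, because \<open>a\<close>
  absorbs \<open>a\<^sup>*\<close>, and dually on \<open>b\<close> as \<open>a\<^sup>*\<close> does.\<close>

lemma plus_dot_middle:
  assumes "a \<in> carrier S" "b \<in> carrier S"
  shows "(a \<cdot> (a\<^bsup>*\<^esup> \<cdot> b\<^bsup>+\<^esup>))\<^bsup>+\<^esup> = (a \<cdot> b)\<^bsup>+\<^esup>"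
proof -
  have "a \<cdot> (a\<^bsup>*\<^esup> \<cdot> b\<^bsup>+\<^esup>) = a \<cdot> b\<^bsup>+\<^esup>"
    using assms by (simp add: dot_assoc [symmetric] star_closed plus_closed star_right_id)
  then show ?thesis
    using assms by (simp add: plus_dot [of a b])
qed

lemma star_dot_middle:
  assumes "a \<in> carrier S" "b \<in> carrier S"
  shows "((a\<^bsup>*\<^esup> \<cdot> b\<^bsup>+\<^esup>) \<cdot> b)\<^bsup>*\<^esup> = (a \<cdot> b)\<^bsup>*\<^esup>"
proof -
  have "(a\<^bsup>*\<^esup> \<cdot> b\<^bsup>+\<^esup>) \<cdot> b = a\<^bsup>*\<^esup> \<cdot> b"
    using assms by (simp add: dot_assoc star_closed plus_closed plus_left_id)
  then show ?thesis
    using assms by (simp add: star_dot [of a b])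
qed

end

context strictly_proper_ehresmann_semigroup
begin

lemma inj_on_edge_of: "inj_on (edge_of S) (carrier S)"
  by (rule inj_onI) (auto simp: edge_of_def sigma_class_eq_iff intro: strictly_proper)

lemma edge_elem_edge_of: "a \<in> carrier S \<Longrightarrow> edge_elem S (edge_of S a) = a"
  by (simp add: edge_elem_def the_inv_into_f_f inj_on_edge_of)

lemma edge_of_dot:
  assumes "a \<in> carrier S" "b \<in> carrier S"
  shows "edge_of S (a \<cdot> b) = edge_of S a \<cdot>\<^bsub>multiaction_product S\<^esub> edge_of S b"
proof -
  have ends: "source (edge_of S c) = c\<^bsup>+\<^esup>" "target (edge_of S c) = c\<^bsup>*\<^esup>"
    "label (edge_of S c) = sigma_class S c" for c
    by (simp_all add: edge_of_def)
  show ?thesis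
    using assms
    by (simp add: multiaction_product_def Let_def corestrict_edge_def restrict_edge_def ends
        edge_elem_edge_of sigma_class_mult plus_dot_middle star_dot_middle)
       (simp add: edge_of_def)
qed

theorem isomorphic_multiaction_product: "biunary_isomorphic S (multiaction_product S)"
proof -
  have carrier: "carrier (multiaction_product S) = edge_of S ` carrier S"
    by (simp add: multiaction_product_def partial_multiaction_def)
  have "edge_of S (x\<^bsup>+\<^esup>) = (edge_of S x)\<^bsup>+\<^esup>\<^bsub>multiaction_product S\<^esub>"
    and "edge_of S (x\<^bsup>*\<^esup>) = (edge_of S x)\<^bsup>*\<^esup>\<^bsub>multiaction_product S\<^esub>"
    if "x \<in> carrier S" for x
    using that by (simp_all add: edge_of_plus edge_of_star)
      (simp_all add: multiaction_product_def edge_of_def)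
  then have "edge_of S \<in> biunary_hom S (multiaction_product S)"
    by (auto simp: biunary_hom_def carrier edge_of_dot)
  moreover have "bij_betw (edge_of S) (carrier S) (carrier (multiaction_product S))"
    by (simp add: bij_betw_def carrier inj_on_edge_of)
  ultimately show ?thesis
    unfolding biunary_isomorphic_def by blast
qed

end

sublocale proper_left_restriction_semigroup \<subseteq> strictly_proper_ehresmann_semigroup
  by unfold_locales (rule left_proper)

sublocale proper_right_restriction_semigroup \<subseteq> strictly_proper_ehresmann_semigroup
  by unfold_locales (rule right_proper)

text \<open>Two edges with a common source and label come from elements \<open>a\<close> and \<open>b\<close> such that
  \<open>a\<^sup>+ = b\<^sup>+\<close> and \<open>[a] = [b]\<close>. Properness makes these elements equal, hence so are their targets.\<close>

lemma (in proper_left_restriction_semigroup) partial_multiaction_LD: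
  "condition_LD (quotient_monoid S) (partial_multiaction S)"
proof -
  have "f = f'" if "(e, t, f) \<in> edge_of S ` carrier S" "(e, t, f') \<in> edge_of S ` carrier S"
    for e t f f'
    using that by (auto simp: edge_of_def sigma_class_eq_iff dest: left_proper)
  then show ?thesis
    by (simp add: condition_LD_def partial_multiaction_def Uniq_def) blast
qed

lemma (in proper_right_restriction_semigroup) partial_multiaction_RD:
  "condition_RD (quotient_monoid S) (partial_multiaction S)"
proof -
  have "e = e'" if "(e, t, f) \<in> edge_of S ` carrier S" "(e', t, f) \<in> edge_of S ` carrier S"
    for e e' t f
    using that by (auto simp: edge_of_def sigma_class_eq_iff dest: right_proper)
  then show ?thesis
    by (simp add: condition_RD_def partial_multiaction_def Uniq_def) blast
qed

theorem corollary6p12: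
  fixes S :: "'a biunary_semigroup"
  shows
    "(proper_left_restriction_semigroup S \<longrightarrow>
        strictly_proper_ehresmann_semigroup S \<and>
        condition_LD (quotient_monoid S) (partial_multiaction S) \<and>
        biunary_isomorphic S (multiaction_product S)) \<and>
     (proper_right_restriction_semigroup S \<longrightarrow>
        strictly_proper_ehresmann_semigroup S \<and>
        condition_RD (quotient_monoid S) (partial_multiaction S) \<and>
        biunary_isomorphic S (multiaction_product S)) \<and>
     (proper_restriction_semigroup S \<longrightarrow>
        strictly_proper_ehresmann_semigroup S \<and>
        condition_LD (quotient_monoid S) (partial_multiaction S) \<and>
        condition_RD (quotient_monoid S) (partial_multiaction S) \<and>
        biunary_isomorphic S (multiaction_product S))"
proof -
  have left: "strictly_proper_ehresmann_semigroup S \<and>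
      condition_LD (quotient_monoid S) (partial_multiaction S) \<and>
      biunary_isomorphic S (multiaction_product S)"
    if "proper_left_restriction_semigroup S"
  proof -
    interpret proper_left_restriction_semigroup S by fact
    show ?thesis
      using strictly_proper_ehresmann_semigroup_axioms partial_multiaction_LD
        isomorphic_multiaction_product by blast
  qed
  have right: "strictly_proper_ehresmann_semigroup S \<and>
      condition_RD (quotient_monoid S) (partial_multiaction S) \<and>
      biunary_isomorphic S (multiaction_product S)"
    if "proper_right_restriction_semigroup S"
  proof -
    interpret proper_right_restriction_semigroup S by fact
    show ?thesis
      using strictly_proper_ehresmann_semigroup_axioms partial_multiaction_RD
        isomorphic_multiaction_product by blast
  qed
  show ?thesis
    using left right by (auto dest: proper_restriction_semigroup.axioms)
qed

end
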